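(* Let $A$ be a simply laced generalized Cartan matrix of untwisted affine type with Dynkin diagram $\Gamma$, let $E$ be a full heap over $\Gamma$, and let $A_0$ be the corresponding finite type generalized Cartan matrix. If $\alpha,\beta,\gamma$ are positive roots associated to $A_0$ such that $\alpha=\beta+\gamma$, then any root heap $L\in\mathcal L_\alpha(E)$ decomposes uniquely as a disjoint union $L=L_1\cup L_2$ of (convex) subheaps $L_1\in\mathcal L_\beta(E)$ and $L_2\in\mathcal L_\gamma(E)$ such that one of $L_1$ and $L_2$ is an ideal of $L$ and the other is a filter of $L$.
   Context: Simply laced generalized Cartan matrix: $a_{pp}=2$, $a_{pq}\in\{0,-1\}$ for $p\ne q$, $a_{pq}=0\iff a_{qp}=0$. Its Dynkin diagram $\Gamma$ has vertex set $P$ indexing the rows, with $p\neq q$ adjacent iff $a_{pq}\ne0$. Simply laced untwisted affine types are $A_l^{(1)}$ ($l\ge2$), $D_l^{(1)}$, $E_6^{(1)}$, $E_7^{(1)}$, $E_8^{(1)}$; $A_0$ is obtained by removing the row and column of the extra vertex $0$, and roots of $A_0$ are regarded as having zero coefficient at $\alpha_0$. Labelled heap over $\Gamma$: $(E,\le,\varepsilon)$ with $(E,\le)$ a locally finite poset and $\varepsilon:E\to P$ such that (1) $\alpha,\beta$ are comparable whenever their labels are equal or adjacent; (2) $\le$ is the transitive closure of "$\alpha\le\beta$ and the labels of $\alpha,\beta$ are equal or adjacent". A heap is an isomorphism class of labelled heaps (work with a representative). $E$ is fibred if (a) each $\varepsilon^{-1}(p)$ is unbounded above and below, and (b) for adjacent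 $p,p'$ and $\varepsilon(\alpha)=p$ there is $\beta$ with $\varepsilon(\beta)=p'$ such that $\alpha$ covers $\beta$ or $\beta$ covers $\alpha$. $E$ is full if it is fibred and every open interval $(\alpha,\beta)$ with $\varepsilon(\alpha)=\varepsilon(\beta)=p$ and containing no element labelled $p$ satisfies $\sum_{\gamma\in(\alpha,\beta)}a_{p,\varepsilon(\gamma)}=-2$. The character of a finite subset $L\subseteq E$ is $\sum_p n_p\alpha_p$ with $n_p$ the number of elements of $L$ labelled $p$. $\mathcal L_\alpha(E)$ is the set of finite convex subsets (subheaps) of $E$ of character $\alpha$; for $\alpha$ a positive root its elements are called root heaps. An ideal (resp. filter) of $L$ is a downward (resp. upward) closed subset of $L$. *)

theory Defs
  imports Main
begin

section \<open>Simply laced generalized Cartan matrices\<close>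

definition simply_laced_gcm :: "'p set \<Rightarrow> ('p \<Rightarrow> 'p \<Rightarrow> int) \<Rightarrow> bool" where
  "simply_laced_gcm P a \<longleftrightarrow> finite P \<and>
     (\<forall>p\<in>P. a p p = 2) \<and>
     (\<forall>p\<in>P. \<forall>q\<in>P. p \<noteq> q \<longrightarrow> a p q \<in> {0, -1}) \<and>
     (\<forall>p\<in>P. \<forall>q\<in>P. a p q = 0 \<longleftrightarrow> a q p = 0)"

definition dynkin_adj :: "('p \<Rightarrow> 'p \<Rightarrow> int) \<Rightarrow> 'p \<Rightarrow> 'p \<Rightarrow> bool" where
  "dynkin_adj a p q \<longleftrightarrow> p \<noteq> q \<and> a p q \<noteq> 0"

text \<open>The simply laced untwisted affine types, with vertices \<open>0, \<dots>, l\<close>. The vertices other than the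
  extra vertex \<open>0\<close> are numbered as in Bourbaki.\<close>

datatype affine_type = A_aff nat | D_aff nat | E6_aff | E7_aff | E8_aff

fun affine_rank :: "affine_type \<Rightarrow> nat" where
  "affine_rank (A_aff l) = l"
| "affine_rank (D_aff l) = l"
| "affine_rank E6_aff = 6"
| "affine_rank E7_aff = 7"
| "affine_rank E8_aff = 8"

text \<open>\<open>A\<^sub>1\<^sup>(\<^sup>1\<^sup>)\<close> is excluded because it is not simply laced in the above sense (its
  off-diagonal entries are \<open>-2\<close>).\<close>

fun valid_affine_type :: "affine_type \<Rightarrow> bool" where
  "valid_affine_type (A_aff l) \<longleftrightarrow> 2 \<le> l"
| "valid_affine_type (D_aff l) \<longleftrightarrow> 4 \<le> l"
| "valid_affine_type E6_aff \<longleftrightarrow> True"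
| "valid_affine_type E7_aff \<longleftrightarrow> True"
| "valid_affine_type E8_aff \<longleftrightarrow> True"

fun affine_edges :: "affine_type \<Rightarrow> (nat \<times> nat) set" where
  "affine_edges (A_aff l) = {(i, Suc i) | i. i < l} \<union> {(l, 0)}"
| "affine_edges (D_aff l) =
     {(0, 2)} \<union> {(i, Suc i) | i. 1 \<le> i \<and> i < l - 1} \<union> {(l - 2, l)}"
| "affine_edges E6_aff = {(1,3), (3,4), (4,5), (5,6), (2,4), (0,2)}"
| "affine_edges E7_aff = {(1,3), (3,4), (4,5), (5,6), (6,7), (2,4), (0,1)}"
| "affine_edges E8_aff = {(1,3), (3,4), (4,5), (5,6), (6,7), (7,8), (2,4), (0,8)}"

definition affine_cartan :: "affine_type \<Rightarrow> nat \<Rightarrow> nat \<Rightarrow> int" where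
  "affine_cartan t i j =
     (if i = j then 2
      else if (i, j) \<in> affine_edges t \<or> (j, i) \<in> affine_edges t then -1 else 0)"

text \<open>The matrix \<open>a\<close> is one of the standard matrices up to a relabelling of the rows that sends the
  extra vertex to \<open>o0\<close>. The matrix \<open>A\<^sub>0\<close> is then \<open>a\<close> restricted to \<open>P - {o0}\<close>.\<close>

definition untwisted_affine :: "'p set \<Rightarrow> ('p \<Rightarrow> 'p \<Rightarrow> int) \<Rightarrow> 'p \<Rightarrow> bool" where
  "untwisted_affine P a o0 \<longleftrightarrow>
     (\<exists>t f. valid_affine_type t \<and> bij_betw f {0..affine_rank t} P \<and> f 0 = o0 \<and>
        (\<forall>i\<le>affine_rank t. \<forall>j\<le>affine_rank t. a (f i) (f j) = affine_cartan t i j))"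


section \<open>Roots\<close>

text \<open>A vector \<open>\<Sum>\<^sub>p n\<^sub>p \<alpha>\<^sub>p\<close> of the root lattice is represented by its coefficient function
  \<open>p \<mapsto> n\<^sub>p\<close>, which vanishes off the index set.\<close>

definition simple_root :: "'p \<Rightarrow> 'p \<Rightarrow> int" where
  "simple_root p = (\<lambda>q. if q = p then 1 else 0)"

definition simple_reflection ::
  "'p set \<Rightarrow> ('p \<Rightarrow> 'p \<Rightarrow> int) \<Rightarrow> 'p \<Rightarrow> ('p \<Rightarrow> int) \<Rightarrow> ('p \<Rightarrow> int)" where
  "simple_reflection I a p v = (\<lambda>q. v q - (\<Sum>r\<in>I. a p r * v r) * simple_root p q)"

inductive_set weyl_group ::
  "'p set \<Rightarrow> ('p \<Rightarrow> 'p \<Rightarrow> int) \<Rightarrow> (('p \<Rightarrow> int) \<Rightarrow> ('p \<Rightarrow> int)) set"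
  for I :: "'p set" and a :: "'p \<Rightarrow> 'p \<Rightarrow> int" where
  weyl_id: "id \<in> weyl_group I a"
| weyl_step: "w \<in> weyl_group I a \<Longrightarrow> p \<in> I \<Longrightarrow> simple_reflection I a p \<circ> w \<in> weyl_group I a"

text \<open>These are the real roots of the matrix \<open>a\<close> with index set \<open>I\<close>; in finite type, where they
  are used, every root is real.\<close>

definition roots :: "'p set \<Rightarrow> ('p \<Rightarrow> 'p \<Rightarrow> int) \<Rightarrow> ('p \<Rightarrow> int) set" where
  "roots I a = {w (simple_root p) | w p. w \<in> weyl_group I a \<and> p \<in> I}"

definition positive_roots :: "'p set \<Rightarrow> ('p \<Rightarrow> 'p \<Rightarrow> int) \<Rightarrow> ('p \<Rightarrow> int) set" where
  "positive_roots I a = {v \<in> roots I a. \<forall>p. 0 \<le> v p}"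


section \<open>Full heaps\<close>

text \<open>The order is a relation on the carrier \<open>E\<close>: \<open>(x, y) \<in> le\<close> means \<open>x \<le> y\<close>.\<close>

definition open_interval :: "'e rel \<Rightarrow> 'e \<Rightarrow> 'e \<Rightarrow> 'e set" where
  "open_interval le x y = {z. (x, z) \<in> le \<and> (z, y) \<in> le \<and> z \<noteq> x \<and> z \<noteq> y}"

definition covers :: "'e rel \<Rightarrow> 'e \<Rightarrow> 'e \<Rightarrow> bool" where
  "covers le y x \<longleftrightarrow> (x, y) \<in> le \<and> x \<noteq> y \<and> open_interval le x y = {}"

locale labelled_heap =
  fixes P :: "'p set" and a :: "'p \<Rightarrow> 'p \<Rightarrow> int"
    and E :: "'e set" and le :: "'e rel" and lab :: "'e \<Rightarrow> 'p"
  assumes partial_order: "partial_order_on E le"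
    and locally_finite: "\<And>x y. finite {z. (x, z) \<in> le \<and> (z, y) \<in> le}"
    and labels: "lab ` E \<subseteq> P"
    and comparable:
      "\<And>x y. x \<in> E \<Longrightarrow> y \<in> E \<Longrightarrow> lab x = lab y \<or> dynkin_adj a (lab x) (lab y) \<Longrightarrow>
         (x, y) \<in> le \<or> (y, x) \<in> le"
    and generated:
      "le = {(x, y) \<in> le. lab x = lab y \<or> dynkin_adj a (lab x) (lab y)}\<^sup>+"

locale fibred_heap = labelled_heap +
  assumes unbounded_above: "\<And>p. p \<in> P \<Longrightarrow> \<not> (\<exists>b\<in>E. \<forall>x\<in>E. lab x = p \<longrightarrow> (x, b) \<in> le)"
    and unbounded_below: "\<And>p. p \<in> P \<Longrightarrow> \<not> (\<exists>b\<in>E. \<forall>x\<in>E. lab x = p \<longrightarrow> (b, x) \<in> le)"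
    and neighbour:
      "\<And>x q. x \<in> E \<Longrightarrow> q \<in> P \<Longrightarrow> dynkin_adj a (lab x) q \<Longrightarrow>
         \<exists>y\<in>E. lab y = q \<and> (covers le x y \<or> covers le y x)"

locale full_heap = fibred_heap +
  assumes interval_sum:
    "\<And>x y. (x, y) \<in> le \<Longrightarrow> x \<noteq> y \<Longrightarrow> lab x = lab y \<Longrightarrow>
       (\<forall>z\<in>open_interval le x y. lab z \<noteq> lab x) \<Longrightarrow>
       (\<Sum>z\<in>open_interval le x y. a (lab x) (lab z)) = -2"


section \<open>Root heaps, ideals and filters\<close>

definition heap_character :: "('e \<Rightarrow> 'p) \<Rightarrow> 'e set \<Rightarrow> 'p \<Rightarrow> int" where
  "heap_character lab L = (\<lambda>p. int (card {x \<in> L. lab x = p}))"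

definition order_convex :: "'e rel \<Rightarrow> 'e set \<Rightarrow> bool" where
  "order_convex le L \<longleftrightarrow> (\<forall>x\<in>L. \<forall>y\<in>L. \<forall>z. (x, z) \<in> le \<longrightarrow> (z, y) \<in> le \<longrightarrow> z \<in> L)"

definition subheaps_of_character ::
  "'e set \<Rightarrow> 'e rel \<Rightarrow> ('e \<Rightarrow> 'p) \<Rightarrow> ('p \<Rightarrow> int) \<Rightarrow> 'e set set" where
  "subheaps_of_character E le lab v =
     {L. L \<subseteq> E \<and> finite L \<and> order_convex le L \<and> heap_character lab L = v}"

definition ideal_of :: "'e rel \<Rightarrow> 'e set \<Rightarrow> 'e set \<Rightarrow> bool" where
  "ideal_of le L I \<longleftrightarrow> I \<subseteq> L \<and> (\<forall>x\<in>I. \<forall>y\<in>L. (y, x) \<in> le \<longrightarrow> y \<in> I)"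

definition filter_of :: "'e rel \<Rightarrow> 'e set \<Rightarrow> 'e set \<Rightarrow> bool" where
  "filter_of le L F \<longleftrightarrow> F \<subseteq> L \<and> (\<forall>x\<in>F. \<forall>y\<in>L. (x, y) \<in> le \<longrightarrow> y \<in> F)"

end

theory Submission
  imports Defs
begin

text \<open>
  Cut the heap by an ideal \<open>K\<close> that meets every chain of equally labelled elements in a proper
  nonempty part. Fullness says that between two consecutive elements labelled \<open>p\<close> there are exactly
  two elements whose labels are adjacent to \<open>p\<close>. Counting how many of the two lie below the cut,
  and subtracting \<open>1\<close>, gives the weight \<open>\<lambda>\<^sub>K(p) \<in> {-1, 0, 1}\<close>: the value \<open>1\<close> means that the next
  element labelled \<open>p\<close> may be added to \<open>K\<close>, the value \<open>-1\<close> that the last one may be removed.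
  Adding an element labelled \<open>p\<close> subtracts the column \<open>a(_, p)\<close> from the weight
  (\<open>weight_insert\<close>, \<open>weight_shift\<close>). So these ideals behave like the weights of a minuscule
  representation: the simple reflection \<open>s\<^sub>p\<close> adds or removes one element labelled \<open>p\<close> or does
  nothing.

  Conjugating, the reflection in any real root \<open>v\<close> also acts: \<open>\<langle>\<lambda>\<^sub>K, v\<rangle>\<close> lies in \<open>{-1, 0, 1}\<close> and
  some proper ideal differs from \<open>K\<close> by exactly \<open>\<langle>\<lambda>\<^sub>K, v\<rangle> v\<close> (\<open>root_reflection_ideal\<close>). Hence a
  piece of character \<open>v\<close>, for a positive root \<open>v\<close>, can be put on top of \<open>K\<close> if and only if
  \<open>\<langle>\<lambda>\<^sub>K, v\<rangle> = 1\<close>: if it can, the pairing drops by \<open>\<langle>v, v\<rangle> = 2\<close> within \<open>{-1, 0, 1}\<close>.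

  Now choose \<open>K\<close> directly below the root heap \<open>L\<close> (\<open>cut_below_subheap\<close>). Then
  \<open>1 = \<langle>\<lambda>\<^sub>K, \<alpha>\<rangle> = \<langle>\<lambda>\<^sub>K, \<beta>\<rangle> + \<langle>\<lambda>\<^sub>K, \<gamma>\<rangle>\<close> with both summands in \<open>{-1, 0, 1}\<close>, so exactly one of them
  is \<open>1\<close> and the other is \<open>0\<close>. The root with pairing \<open>1\<close> is the character of an ideal of \<open>L\<close>, the
  other one is not, and the complement of the ideal is the required filter. An ideal of \<open>L\<close> is
  determined by its character, because it consists of an initial segment of each chain.
\<close>

section \<open>Lattice vectors and reflections\<close>

lemma simply_laced_sym:
  assumes "simply_laced_gcm P a" "p \<in> P" "q \<in> P"
  shows "a p q = a q p"
proof (cases "p = q")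
  case False
  then have "a p q \<in> {0, -1}" "a q p \<in> {0, -1}" "a p q = 0 \<longleftrightarrow> a q p = 0"
    using assms unfolding simply_laced_gcm_def by metis+
  then show ?thesis by auto
qed simp

definition cartan_apply :: "'p set \<Rightarrow> ('p \<Rightarrow> 'p \<Rightarrow> int) \<Rightarrow> ('p \<Rightarrow> int) \<Rightarrow> 'p \<Rightarrow> int" where
  "cartan_apply P a v p = (\<Sum>r\<in>P. a p r * v r)"

definition pairing :: "'p set \<Rightarrow> ('p \<Rightarrow> int) \<Rightarrow> ('p \<Rightarrow> int) \<Rightarrow> int" where
  "pairing P u v = (\<Sum>r\<in>P. u r * v r)"

lemma cartan_apply_add_multiple:
  "cartan_apply P a (\<lambda>q. v q + c * w q) p = cartan_apply P a v p + c * cartan_apply P a w p"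
  by (simp add: cartan_apply_def sum.distrib sum_distrib_left algebra_simps)

lemma cartan_apply_multiple:
  "cartan_apply P a (\<lambda>q. c * w q) p = c * cartan_apply P a w p"
  by (simp add: cartan_apply_def sum_distrib_left algebra_simps)

lemma pairing_add_left_multiple:
  "pairing P (\<lambda>q. u q + c * w q) v = pairing P u v + c * pairing P w v"
  by (simp add: pairing_def sum.distrib sum_distrib_left algebra_simps)

lemma pairing_add_right_multiple:
  "pairing P u (\<lambda>q. v q + c * w q) = pairing P u v + c * pairing P u w"
  by (simp add: pairing_def sum.distrib sum_distrib_left algebra_simps)

lemma pairing_commute: "pairing P u v = pairing P v u"
  by (simp add: pairing_def mult.commute)

lemma cartan_apply_simple_root:
  assumes "finite P" "p \<in> P"
  shows "cartan_apply P a (simple_root p) q = a q p"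
proof -
  have "cartan_apply P a (simple_root p) q = (\<Sum>r\<in>P. if r = p then a q p else 0)"
    unfolding cartan_apply_def simple_root_def by (intro sum.cong) auto
  then show ?thesis using assms by simp
qed

lemma pairing_simple_root:
  assumes "finite P" "p \<in> P"
  shows "pairing P u (simple_root p) = u p"
proof -
  have "pairing P u (simple_root p) = (\<Sum>r\<in>P. if r = p then u p else 0)"
    unfolding pairing_def simple_root_def by (intro sum.cong) auto
  then show ?thesis using assms by simp
qed

lemma pairing_cartan_column:
  assumes "simply_laced_gcm P a" "p \<in> P"
  shows "pairing P (\<lambda>q. a q p) v = cartan_apply P a v p"
  unfolding pairing_def cartan_apply_def
  by (intro sum.cong refl) (simp add: simply_laced_sym[OF assms(1) _ assms(2)])

lemma simple_reflection_supported:
  assumes "finite P" "I \<subseteq> P" "\<And>q. q \<notin> I \<Longrightarrow> v q = 0"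
  shows "simple_reflection I a p v = (\<lambda>q. v q + (- cartan_apply P a v p) * simple_root p q)"
proof -
  have "(\<Sum>r\<in>I. a p r * v r) = cartan_apply P a v p"
    unfolding cartan_apply_def using assms by (intro sum.mono_neutral_left) auto
  then show ?thesis by (simp add: simple_reflection_def)
qed

text \<open>The form \<open>v\<^sup>T a v\<close> takes the value \<open>2\<close> on simple roots and is invariant under reflections
  because \<open>a\<close> is symmetric. The support condition is what lets sums over \<open>I\<close> be replaced by
  sums over all of \<open>P\<close>.\<close>

lemma root_supported_and_norm:
  assumes gcm: "simply_laced_gcm P a" and "I \<subseteq> P" and "v \<in> roots I a"
  shows "(\<forall>q. q \<notin> I \<longrightarrow> v q = 0) \<and> pairing P v (cartan_apply P a v) = 2"
proof -
  have fin: "finite P" using gcm by (simp add: simply_laced_gcm_def)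
  obtain w p where w: "w \<in> weyl_group I a" and p: "p \<in> I" and v: "v = w (simple_root p)"
    using assms(3) by (auto simp: roots_def)
  have "(\<forall>q. q \<notin> I \<longrightarrow> w (simple_root p) q = 0) \<and>
      pairing P (w (simple_root p)) (cartan_apply P a (w (simple_root p))) = 2"
    using w
  proof induction
    case weyl_id
    have pP: "p \<in> P" using p assms(2) by auto
    have "a p p = 2" using gcm pP by (auto simp: simply_laced_gcm_def)
    moreover have "pairing P (simple_root p) (cartan_apply P a (simple_root p)) = a p p"
      using pP by (subst pairing_commute) (simp add: pairing_simple_root fin cartan_apply_simple_root)
    ultimately show ?case using p by (auto simp: simple_root_def)
  next
    case (weyl_step w' q)
    define v where "v = w' (simple_root p)"
    have qP: "q \<in> P" using weyl_step(2) assms(2) by auto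
    have aqq: "a q q = 2" using gcm qP by (auto simp: simply_laced_gcm_def)
    have supp: "\<And>r. r \<notin> I \<Longrightarrow> v r = 0" and norm: "pairing P v (cartan_apply P a v) = 2"
      using weyl_step(3) by (auto simp: v_def)
    define c where "c = - cartan_apply P a v q"
    have s: "simple_reflection I a q v = (\<lambda>r. v r + c * simple_root q r)"
      unfolding c_def by (rule simple_reflection_supported[OF fin assms(2) supp])
    have "cartan_apply P a (\<lambda>r. v r + c * simple_root q r) = (\<lambda>r. cartan_apply P a v r + c * a r q)"
      by (rule ext) (simp add: cartan_apply_add_multiple cartan_apply_simple_root[OF fin qP])
    moreover have "pairing P v (\<lambda>r. cartan_apply P a v r + c * a r q) =
        2 + c * cartan_apply P a v q"
      using pairing_cartan_column[OF gcm qP, of v] norm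
      by (subst pairing_add_right_multiple) (simp add: pairing_commute)
    moreover have "pairing P (simple_root q) (\<lambda>r. cartan_apply P a v r + c * a r q) =
        cartan_apply P a v q + c * 2"
      using aqq by (subst pairing_commute) (simp add: pairing_simple_root[OF fin qP])
    ultimately have "pairing P (simple_reflection I a q v)
        (cartan_apply P a (simple_reflection I a q v)) = 2"
      unfolding s by (simp only: pairing_add_left_multiple) (simp add: c_def algebra_simps)
    moreover have "\<forall>r. r \<notin> I \<longrightarrow> simple_reflection I a q v r = 0"
      using supp weyl_step(2) by (auto simp: s simple_root_def)
    ultimately show ?case by (simp add: v_def)
  qed
  then show ?thesis by (simp add: v)
qed

section \<open>Finite chains and uniqueness of pairs\<close>

lemma finite_total_has_greatest:
  assumes "finite F" "F \<noteq> {}" "trans r" "\<And>x y. x \<in> F \<Longrightarrow> y \<in> F \<Longrightarrow> (x, y) \<in> r \<or> (y, x) \<in> r"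
  shows "\<exists>m\<in>F. \<forall>x\<in>F. (x, m) \<in> r"
  using assms(1,2,4)
proof (induction F rule: finite_ne_induct)
  case (insert x F)
  then obtain m where m: "m \<in> F" "\<forall>y\<in>F. (y, m) \<in> r" by blast
  show ?case
  proof (cases "(x, m) \<in> r")
    case False
    then have mx: "(m, x) \<in> r" using insert.prems m by blast
    have "(x, x) \<in> r" using insert.prems by blast
    moreover have "(y, x) \<in> r" if "y \<in> F" for y
      using m mx that transD[OF assms(3)] by blast
    ultimately show ?thesis by blast
  qed (use m in blast)
qed blast

lemma ex1_pairI:
  assumes "R x y" and "\<And>x' y'. R x' y' \<Longrightarrow> x' = x \<and> y' = y"
  shows "\<exists>!(x, y). R x y"
proof (rule ex1I[of _ "(x, y)"])
  show "case (x, y) of (x, y) \<Rightarrow> R x y" using assms(1) by simp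
  fix z assume z: "case z of (x, y) \<Rightarrow> R x y"
  obtain u v where "z = (u, v)" by (cases z)
  then show "z = (x, y)" using z assms(2)[of u v] by simp
qed

section \<open>Proper ideals and their weights\<close>

locale simply_laced_full_heap = full_heap +
  assumes gcm: "simply_laced_gcm P a"
begin

lemma finite_P: "finite P" and diag: "p \<in> P \<Longrightarrow> a p p = 2"
  using gcm by (auto simp: simply_laced_gcm_def)

lemma offdiag: "p \<in> P \<Longrightarrow> q \<in> P \<Longrightarrow> p \<noteq> q \<Longrightarrow> a p q = (if dynkin_adj a p q then -1 else 0)"
  using gcm unfolding simply_laced_gcm_def dynkin_adj_def by (metis insert_iff singletonD)

lemma adj_sym: "p \<in> P \<Longrightarrow> q \<in> P \<Longrightarrow> dynkin_adj a p q \<longleftrightarrow> dynkin_adj a q p"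
  using gcm unfolding simply_laced_gcm_def dynkin_adj_def by metis

lemma le_in_E: "(x, y) \<in> le \<Longrightarrow> x \<in> E \<and> y \<in> E"
  using partial_order by (auto simp: partial_order_on_def preorder_on_def)

lemma le_refl: "x \<in> E \<Longrightarrow> (x, x) \<in> le"
  using partial_order by (auto simp: partial_order_on_def preorder_on_def refl_on_def)

lemma trans_le: "trans le" and antisym_le: "antisym le"
  using partial_order by (auto simp: partial_order_on_def preorder_on_def)

lemmas le_trans = transD[OF trans_le]
lemmas le_antisym = antisymD[OF antisym_le]

lemma lab_in_P: "x \<in> E \<Longrightarrow> lab x \<in> P"
  using labels by auto

text \<open>Meeting each chain properly is what makes the frontier between \<open>K\<close> and its complement, and hence
  the weight of \<open>K\<close>, defined at every label.\<close>
definition proper_ideal :: "'b set \<Rightarrow> bool" where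
  "proper_ideal K \<longleftrightarrow> K \<subseteq> E \<and> (\<forall>x\<in>K. \<forall>y. (y, x) \<in> le \<longrightarrow> y \<in> K) \<and>
     (\<forall>p\<in>P. (\<exists>x\<in>K. lab x = p) \<and> (\<exists>y\<in>E - K. lab y = p))"

lemma proper_ideal_sub: "proper_ideal K \<Longrightarrow> x \<in> K \<Longrightarrow> x \<in> E"
  by (auto simp: proper_ideal_def)

lemma proper_ideal_down: "proper_ideal K \<Longrightarrow> x \<in> K \<Longrightarrow> (y, x) \<in> le \<Longrightarrow> y \<in> K"
  unfolding proper_ideal_def by blast

lemma proper_ideal_between:
  assumes "proper_ideal J" "proper_ideal M" "J \<subseteq> K" "K \<subseteq> M"
    and "\<And>x y. x \<in> K \<Longrightarrow> (y, x) \<in> le \<Longrightarrow> y \<in> K"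
  shows "proper_ideal K"
  unfolding proper_ideal_def
proof (intro conjI ballI allI impI)
  show "K \<subseteq> E" using assms(2,4) by (auto simp: proper_ideal_def)
next
  fix p assume "p \<in> P"
  then show "\<exists>x\<in>K. lab x = p" using assms(1,3) unfolding proper_ideal_def by blast
next
  fix p assume "p \<in> P"
  then show "\<exists>y\<in>E - K. lab y = p" using assms(2,4) unfolding proper_ideal_def by blast
qed (use assms(5) in blast)

lemma proper_ideal_Un:
  assumes J: "proper_ideal J" and K: "proper_ideal K"
  shows "proper_ideal (J \<union> K)"
  unfolding proper_ideal_def
proof (intro conjI ballI allI impI)
  fix p assume p: "p \<in> P"
  then show "\<exists>x\<in>J \<union> K. lab x = p" using J unfolding proper_ideal_def by blast
  obtain y where y: "y \<in> E - J" "lab y = p" using J p unfolding proper_ideal_def by blast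
  obtain z where z: "z \<in> E - K" "lab z = p" using K p unfolding proper_ideal_def by blast
  have "(y, z) \<in> le \<or> (z, y) \<in> le" using comparable[of y z] y z by auto
  then have "y \<notin> K \<or> z \<notin> J" using y z proper_ideal_down[OF J] proper_ideal_down[OF K] by blast
  then show "\<exists>y\<in>E - (J \<union> K). lab y = p" using y z by blast
qed (use J K proper_ideal_sub proper_ideal_down in blast)+

text \<open>The interval between an element of \<open>K\<close> and an element outside it with the same label is finite,
  so the chain labelled \<open>p\<close> has a last element \<open>x\<close> in \<open>K\<close> and a first element \<open>y\<close> outside \<open>K\<close>.
  These two are consecutive.\<close>

lemma frontier:
  assumes K: "proper_ideal K" and p: "p \<in> P"
  obtains x y where "x \<in> K" "lab x = p" "y \<in> E - K" "lab y = p"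
    "\<And>u. u \<in> K \<Longrightarrow> lab u = p \<Longrightarrow> (u, x) \<in> le"
    "\<And>u. u \<in> E - K \<Longrightarrow> lab u = p \<Longrightarrow> (y, u) \<in> le"
proof -
  obtain x0 y0 where x0: "x0 \<in> K" "lab x0 = p" and y0: "y0 \<in> E - K" "lab y0 = p"
    using K p unfolding proper_ideal_def by blast
  have cmp: "(u, v) \<in> le \<or> (v, u) \<in> le" if "u \<in> E" "v \<in> E" "lab u = p" "lab v = p" for u v
    using comparable that by simp
  have KE: "K \<subseteq> E" using K by (simp add: proper_ideal_def)
  have sep: "(u, v) \<in> le" if "u \<in> K" "v \<in> E - K" "lab u = p" "lab v = p" for u v
    using cmp[of u v] that KE proper_ideal_down[OF K] by blast
  let ?F = "{u. (x0, u) \<in> le \<and> (u, y0) \<in> le}"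
  let ?X = "{u \<in> ?F. u \<in> K \<and> lab u = p}" and ?Y = "{u \<in> ?F. u \<in> E - K \<and> lab u = p}"
  have "\<exists>m\<in>?X. \<forall>u\<in>?X. (u, m) \<in> le"
  proof (rule finite_total_has_greatest)
    show "?X \<noteq> {}" using x0 y0 sep le_refl KE by blast
    show "finite ?X" by (rule finite_subset[OF _ locally_finite[of x0 y0]]) auto
  qed (use trans_le cmp KE in auto)
  then obtain x where x: "x \<in> ?X" "\<forall>u\<in>?X. (u, x) \<in> le" ..
  have "\<exists>m\<in>?Y. \<forall>u\<in>?Y. (u, m) \<in> le\<inverse>"
  proof (rule finite_total_has_greatest)
    show "?Y \<noteq> {}" using x0 y0 sep le_refl by blast
    show "finite ?Y" by (rule finite_subset[OF _ locally_finite[of x0 y0]]) auto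
    show "trans (le\<inverse>)" using trans_le by simp
  qed (use cmp in auto)
  then obtain y where y: "y \<in> ?Y" "\<forall>u\<in>?Y. (u, y) \<in> le\<inverse>" ..
  show thesis
  proof (rule that[of x y])
    fix u assume u: "u \<in> K" "lab u = p"
    show "(u, x) \<in> le"
    proof (cases "(x0, u) \<in> le")
      case True then show ?thesis using x u sep[of u y0] y0 by blast
    next
      case False
      then have "(u, x0) \<in> le" using cmp u x0 KE by blast
      then show ?thesis using x le_trans by blast
    qed
  next
    fix u assume u: "u \<in> E - K" "lab u = p"
    show "(y, u) \<in> le"
    proof (cases "(u, y0) \<in> le")
      case True then show ?thesis using y u sep[of x0 u] x0 by blast
    next
      case False
      then have "(y0, u) \<in> le" using cmp u y0 by blast
      then show ?thesis using y le_trans by blast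
    qed
  qed (use x y in auto)
qed

text \<open>Together with \<open>nbrs_above\<close> these are the elements with label adjacent to \<open>p\<close> in the interval
  between the two frontier elements of the chain labelled \<open>p\<close>. The description by bounds avoids
  naming the frontier elements.\<close>
definition nbrs_below :: "'b set \<Rightarrow> 'a \<Rightarrow> 'b set" where
  "nbrs_below K p =
     {z \<in> K. dynkin_adj a p (lab z) \<and> (\<forall>x\<in>K. lab x = p \<longrightarrow> (x, z) \<in> le)}"

definition nbrs_above :: "'b set \<Rightarrow> 'a \<Rightarrow> 'b set" where
  "nbrs_above K p =
     {z \<in> E - K. dynkin_adj a p (lab z) \<and> (\<forall>y\<in>E - K. lab y = p \<longrightarrow> (z, y) \<in> le)}"

text \<open>This is where fullness enters: the summands over the frontier interval are \<open>-1\<close> at labels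
  adjacent to \<open>p\<close> and \<open>0\<close> elsewhere, so the sum \<open>-2\<close> counts two such elements.\<close>

lemma nbrs_two:
  assumes K: "proper_ideal K" and p: "p \<in> P"
  shows "finite (nbrs_below K p)" "finite (nbrs_above K p)"
    "card (nbrs_below K p) + card (nbrs_above K p) = 2"
proof -
  obtain x y where x: "x \<in> K" "lab x = p" and y: "y \<in> E - K" "lab y = p"
    and xmax: "\<And>u. u \<in> K \<Longrightarrow> lab u = p \<Longrightarrow> (u, x) \<in> le"
    and ymin: "\<And>u. u \<in> E - K \<Longrightarrow> lab u = p \<Longrightarrow> (y, u) \<in> le"
    using frontier[OF K p] by metis
  have KE: "K \<subseteq> E" using K by (simp add: proper_ideal_def)
  have xy: "(x, y) \<in> le" "x \<noteq> y"
    using comparable[of x y] x y KE proper_ideal_down[OF K] by auto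
  let ?O = "open_interval le x y"
  let ?S = "{z \<in> ?O. dynkin_adj a p (lab z)}"
  have cmp: "(x, z) \<in> le \<or> (z, x) \<in> le" "(y, z) \<in> le \<or> (z, y) \<in> le"
    if "z \<in> E" "dynkin_adj a p (lab z)" for z
    using comparable[of x z] comparable[of y z] that x y KE by auto
  have adjne: "z \<noteq> x \<and> z \<noteq> y" if "dynkin_adj a p (lab z)" for z
    using that x y by (auto simp: dynkin_adj_def)
  have bel: "nbrs_below K p = ?S \<inter> K"
  proof (intro equalityI subsetI)
    fix z assume z: "z \<in> nbrs_below K p"
    then have "(y, z) \<notin> le" using proper_ideal_down[OF K] y by (auto simp: nbrs_below_def)
    then show "z \<in> ?S \<inter> K" using z cmp[of z] KE adjne[of z] x
      by (auto simp: nbrs_below_def open_interval_def)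
  next
    fix z assume z: "z \<in> ?S \<inter> K"
    then have "(x, z) \<in> le" by (simp add: open_interval_def)
    then have "\<forall>u\<in>K. lab u = p \<longrightarrow> (u, z) \<in> le" using xmax le_trans by blast
    then show "z \<in> nbrs_below K p" using z by (simp add: nbrs_below_def)
  qed
  have abo: "nbrs_above K p = ?S - K"
  proof (intro equalityI subsetI)
    fix z assume z: "z \<in> nbrs_above K p"
    then have "(z, x) \<notin> le" using proper_ideal_down[OF K] x by (auto simp: nbrs_above_def)
    then show "z \<in> ?S - K" using z cmp[of z] adjne[of z] y
      by (auto simp: nbrs_above_def open_interval_def)
  next
    fix z assume z: "z \<in> ?S - K"
    then have zy: "(z, y) \<in> le" by (simp add: open_interval_def)
    then have "\<forall>u\<in>E - K. lab u = p \<longrightarrow> (z, u) \<in> le" using ymin le_trans by blast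
    then show "z \<in> nbrs_above K p" using z zy le_in_E by (simp add: nbrs_above_def)
  qed
  have finO: "finite ?O"
    by (rule finite_subset[OF _ locally_finite[of x y]]) (auto simp: open_interval_def)
  then have finS: "finite ?S" by simp
  have nop: "\<forall>z\<in>?O. lab z \<noteq> lab x"
  proof
    fix z assume z: "z \<in> ?O"
    show "lab z \<noteq> lab x"
    proof
      assume l: "lab z = lab x"
      have "z \<in> E" using z le_in_E by (auto simp: open_interval_def)
      then show False
        using z l x y xmax[of z] ymin[of z] le_antisym[of x z] le_antisym[of z y]
        by (cases "z \<in> K") (auto simp: open_interval_def)
    qed
  qed
  have "-2 = (\<Sum>z\<in>?O. a p (lab z))"
    using interval_sum[OF xy(1,2) _ nop] x y by simp
  also have "\<dots> = (\<Sum>z\<in>?O. if dynkin_adj a p (lab z) then -1 else 0)"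
  proof (rule sum.cong[OF refl])
    fix z assume "z \<in> ?O"
    then have "z \<in> E" "lab z \<noteq> p" using nop x le_in_E by (auto simp: open_interval_def)
    then show "a p (lab z) = (if dynkin_adj a p (lab z) then -1 else 0)"
      using offdiag[OF p lab_in_P] by auto
  qed
  also have "\<dots> = - int (card ?S)"
    using finO by (simp add: sum.If_cases Int_def)
  finally have "card ?S = 2" by simp
  then show "finite (nbrs_below K p)" "finite (nbrs_above K p)"
    "card (nbrs_below K p) + card (nbrs_above K p) = 2"
    using finS card_Int_Diff[OF finS, of K] by (auto simp: bel abo)
qed

text \<open>As a function of \<open>p\<close> this is the weight \<open>\<lambda>\<^sub>K\<close>, evaluated on the simple coroots.\<close>
definition weight :: "'b set \<Rightarrow> 'a \<Rightarrow> int" where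
  "weight K p = int (card (nbrs_below K p)) - 1"

lemma weight_range:
  assumes "proper_ideal K" "p \<in> P"
  shows "weight K p \<in> {-1, 0, 1}"
  using nbrs_two(3)[OF assms] by (auto simp: weight_def)

text \<open>If \<open>z\<close> is labelled \<open>p\<close>, then both neighbours lie in \<open>K\<close>, while no element of \<open>K\<close> lies above
  \<open>z\<close>, so the weight at \<open>p\<close> drops from \<open>1\<close> to \<open>-1\<close>. If the label of \<open>z\<close> is adjacent to \<open>p\<close>, then
  \<open>z\<close> joins the lower neighbours. Otherwise the neighbours do not change.\<close>

lemma weight_insert:
  assumes K: "proper_ideal K" and z: "z \<in> E - K" and zK: "proper_ideal (insert z K)" and p: "p \<in> P"
  shows "weight (insert z K) p = weight K p - a p (lab z)"
proof -
  have zE: "z \<in> E" using z by simp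
  consider "lab z = p" | "lab z \<noteq> p" "dynkin_adj a p (lab z)" | "lab z \<noteq> p" "\<not> dynkin_adj a p (lab z)"
    by blast
  then show ?thesis
  proof cases
    case 1
    have "nbrs_below (insert z K) p = {}"
      using 1 z proper_ideal_down[OF K] by (auto simp: nbrs_below_def dynkin_adj_def)
    moreover have "nbrs_above K p = {}"
      using 1 z proper_ideal_down[OF zK] by (auto simp: nbrs_above_def dynkin_adj_def)
    ultimately show ?thesis using nbrs_two(3)[OF K p] 1 diag[OF p] by (simp add: weight_def)
  next
    case 2
    have above: "(x, z) \<in> le" if "x \<in> K" "lab x = p" for x
      using comparable[of x z] that 2 z proper_ideal_down[OF K] proper_ideal_sub[OF K] by auto
    have "nbrs_below (insert z K) p = insert z (nbrs_below K p)"
      using 2 above by (auto simp: nbrs_below_def)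
    moreover have "z \<notin> nbrs_below K p" using z by (auto simp: nbrs_below_def)
    ultimately show ?thesis
      using nbrs_two(1)[OF K p] 2 offdiag[OF p lab_in_P[OF zE]] by (simp add: weight_def)
  next
    case 3
    then have "nbrs_below (insert z K) p = nbrs_below K p" by (auto simp: nbrs_below_def)
    then show ?thesis using 3 offdiag[OF p lab_in_P[OF zE]] by (simp add: weight_def)
  qed
qed

lemma finite_proper_diff:
  assumes J: "proper_ideal J" and K: "proper_ideal K"
  shows "finite (K - J)"
proof -
  have "finite {z \<in> K - J. lab z = p}" if p: "p \<in> P" for p
  proof -
    obtain x y where x: "x \<in> J" "lab x = p" and y: "y \<in> E - K" "lab y = p"
      using J K p unfolding proper_ideal_def by blast
    have "{z \<in> K - J. lab z = p} \<subseteq> {z. (x, z) \<in> le \<and> (z, y) \<in> le}"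
    proof safe
      fix z assume z: "z \<in> K" "z \<notin> J" "p = lab z"
      show "(x, z) \<in> le" "(z, y) \<in> le"
        using z x y comparable[of x z] comparable[of z y] proper_ideal_sub[OF J] proper_ideal_sub[OF K]
          proper_ideal_down[OF J] proper_ideal_down[OF K] by auto
    qed
    then show ?thesis using locally_finite finite_subset by blast
  qed
  then have "finite (\<Union>p\<in>P. {z \<in> K - J. lab z = p})" using finite_P by blast
  moreover have "K - J \<subseteq> (\<Union>p\<in>P. {z \<in> K - J. lab z = p})"
    using lab_in_P proper_ideal_sub[OF K] by blast
  ultimately show ?thesis by (rule rev_finite_subset)
qed

text \<open>Remove the elements of \<open>M\<close> one at a time, each time a maximal one, so that all intermediate
  sets are proper ideals.\<close>

lemma weight_Un:
  assumes K: "proper_ideal K" and p: "p \<in> P"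
  shows "finite M \<Longrightarrow> proper_ideal (K \<union> M) \<Longrightarrow> K \<inter> M = {} \<Longrightarrow>
    weight (K \<union> M) p = weight K p - (\<Sum>z\<in>M. a p (lab z))"
proof (induction "card M" arbitrary: M)
  case (Suc n)
  have "\<exists>m\<in>M. \<forall>x\<in>M. (m, x) \<in> le \<longrightarrow> x = m"
  proof -
    have "asymp_on M (\<lambda>x y. (x, y) \<in> le \<and> x \<noteq> y)"
      using le_antisym by (intro asymp_onI) blast
    moreover have "transp_on M (\<lambda>x y. (x, y) \<in> le \<and> x \<noteq> y)"
      using le_antisym le_trans by (intro transp_onI) blast
    moreover have "M \<noteq> {}" using Suc.hyps(2) by auto
    ultimately have "\<exists>m\<in>M. \<forall>x\<in>M. x \<noteq> m \<longrightarrow> \<not> ((m, x) \<in> le \<and> m \<noteq> x)"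
      using Finite_Set.bex_max_element[OF Suc.prems(1)] by blast
    then show ?thesis by blast
  qed
  then obtain m where m: "m \<in> M" "\<And>x. x \<in> M \<Longrightarrow> (m, x) \<in> le \<Longrightarrow> x = m" by blast
  have KM: "proper_ideal (K \<union> (M - {m}))"
  proof (rule proper_ideal_between[OF K Suc.prems(2)])
    fix x y assume x: "x \<in> K \<union> (M - {m})" and yx: "(y, x) \<in> le"
    have "y \<in> K \<union> M" using proper_ideal_down[OF Suc.prems(2) _ yx] x by blast
    moreover have "y \<noteq> m" using x m yx proper_ideal_down[OF K] Suc.prems(3) by blast
    ultimately show "y \<in> K \<union> (M - {m})" by blast
  qed auto
  have ins: "K \<union> M = insert m (K \<union> (M - {m}))" using m by auto
  have "weight (K \<union> M) p = weight (K \<union> (M - {m})) p - a p (lab m)"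
    unfolding ins
    by (rule weight_insert[OF KM _ _ p])
      (use m Suc.prems proper_ideal_sub[OF Suc.prems(2)] in \<open>auto simp flip: ins\<close>)
  moreover have "weight (K \<union> (M - {m})) p = weight K p - (\<Sum>z\<in>M - {m}. a p (lab z))"
    by (rule Suc.hyps(1)) (use Suc m KM in auto)
  ultimately show ?case using m Suc.prems(1) by (simp add: sum.remove)
qed simp

lemma sum_labels:
  assumes "finite M" "M \<subseteq> E"
  shows "(\<Sum>z\<in>M. a p (lab z)) = cartan_apply P a (heap_character lab M) p"
proof -
  have "(\<Sum>z\<in>M. a p (lab z)) = (\<Sum>r\<in>P. \<Sum>z\<in>{z\<in>M. lab z = r}. a p (lab z))"
    using assms finite_P lab_in_P by (intro sum.group[symmetric]) auto
  also have "\<dots> = cartan_apply P a (heap_character lab M) p"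
    unfolding cartan_apply_def heap_character_def
    by (intro sum.cong refl) (simp add: mult.commute)
  finally show ?thesis .
qed

definition shift :: "'b set \<Rightarrow> 'b set \<Rightarrow> 'a \<Rightarrow> int" where
  "shift J K = (\<lambda>p. heap_character lab (K - J) p - heap_character lab (J - K) p)"

lemma shift_subset: "J \<subseteq> K \<Longrightarrow> shift J K = heap_character lab (K - J)"
  by (simp add: shift_def heap_character_def fun_eq_iff Diff_eq_empty_iff[THEN iffD2])

lemma shift_swap: "shift K J = (\<lambda>p. - shift J K p)"
  by (simp add: shift_def)

lemma shift_via_superset:
  assumes U: "J \<union> K \<subseteq> U" and "finite (U - J)" "finite (U - K)"
  shows "shift J K p = heap_character lab (U - J) p - heap_character lab (U - K) p"
proof -
  have *: "card {z \<in> U - X. lab z = p} = card {z \<in> U - (X \<union> Y). lab z = p} + card {z \<in> Y - X. lab z = p}"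
    if "X \<union> Y \<subseteq> U" "finite (U - X)" for X Y
    by (subst card_Un_disjoint[symmetric])
      (use that in \<open>auto intro!: arg_cong[where f=card] intro: rev_finite_subset\<close>)
  show ?thesis
    using *[of J K] *[of K J] assms by (simp add: shift_def heap_character_def Un_commute)
qed

lemma shift_add:
  assumes J: "proper_ideal J" and K: "proper_ideal K" and M: "proper_ideal M"
  shows "shift J M p = shift J K p + shift K M p"
proof -
  let ?U = "J \<union> K \<union> M"
  have U: "proper_ideal ?U" using J K M by (intro proper_ideal_Un)
  note fin = finite_proper_diff[OF J U] finite_proper_diff[OF K U] finite_proper_diff[OF M U]
  have "J \<union> M \<subseteq> ?U" "J \<union> K \<subseteq> ?U" "K \<union> M \<subseteq> ?U" by blast+
  then show ?thesis
    by (simp only: shift_via_superset[of J M ?U p] shift_via_superset[of J K ?U p]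
        shift_via_superset[of K M ?U p] fin)
qed

text \<open>Two proper ideals are compared through their union, which contains both with finite difference.\<close>

lemma weight_shift:
  assumes J: "proper_ideal J" and K: "proper_ideal K" and p: "p \<in> P"
  shows "weight K p = weight J p - cartan_apply P a (shift J K) p"
proof -
  have *: "weight (X \<union> Y) p = weight X p - cartan_apply P a (heap_character lab (Y - X)) p"
    if "proper_ideal X" "proper_ideal Y" for X Y
    using weight_Un[OF that(1) p, of "Y - X"] finite_proper_diff[OF that] proper_ideal_Un[OF that]
      sum_labels[of "Y - X"] proper_ideal_sub[OF that(2)] by auto
  have "shift J K = (\<lambda>q. heap_character lab (K - J) q + (-1) * heap_character lab (J - K) q)"
    by (simp add: shift_def)
  then have "cartan_apply P a (shift J K) p = cartan_apply P a (heap_character lab (K - J)) p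
      - cartan_apply P a (heap_character lab (J - K)) p"
    by (simp add: cartan_apply_add_multiple[where c = "-1", simplified])
  then show ?thesis using *[OF J K] *[OF K J] by (simp add: Un_commute)
qed

text \<open>On each chain the two ideals are initial segments, hence nested, so that the sign of the shift
  decides which one is larger.\<close>

lemma subset_if_shift_nonneg:
  assumes J: "proper_ideal J" and K: "proper_ideal K" and nonneg: "\<And>p. 0 \<le> shift J K p"
  shows "J \<subseteq> K"
proof
  fix x assume xJ: "x \<in> J"
  show "x \<in> K"
  proof (rule ccontr)
    assume xK: "x \<notin> K"
    have "finite {z \<in> J - K. lab z = lab x}" 
      by (rule finite_subset[OF _ finite_proper_diff[OF K J]]) blast
    then have "0 < card {z \<in> J - K. lab z = lab x}" using xJ xK by (auto simp: card_gt_0_iff)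
    then have "0 < card {z \<in> K - J. lab z = lab x}"
      using nonneg[of "lab x"] by (simp add: shift_def heap_character_def)
    then obtain z where z: "z \<in> K" "z \<notin> J" "lab z = lab x"
      by (auto simp: card_gt_0_iff)
    then show False
      using comparable[of x z] xJ xK proper_ideal_sub[OF J] proper_ideal_sub[OF K]
        proper_ideal_down[OF J] proper_ideal_down[OF K] by auto
  qed
qed

section \<open>The Weyl group action on proper ideals\<close>

text \<open>The candidate is the first element \<open>y\<close> of its chain outside \<open>K\<close>. The order is generated by
  comparabilities between equal or adjacent labels, so an obstruction below \<open>y\<close> yields one
  immediately before \<open>y\<close> whose label is \<open>p\<close> or adjacent to \<open>p\<close>. The first contradicts the choice
  of \<open>y\<close>, the second is an upper neighbour.\<close>

lemma addable:
  assumes K: "proper_ideal K" and p: "p \<in> P" and none: "nbrs_above K p = {}"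
  shows "\<exists>z\<in>E - K. lab z = p \<and> proper_ideal (insert z K)"
proof -
  obtain y where y: "y \<in> E - K" "lab y = p"
    and ymin: "\<And>u. u \<in> E - K \<Longrightarrow> lab u = p \<Longrightarrow> (y, u) \<in> le"
    using frontier[OF K p] by metis
  have down: "w \<in> insert y K" if "(w, y) \<in> le" for w
  proof (rule ccontr)
    assume w: "w \<notin> insert y K"
    let ?R = "{(x, y) \<in> le. lab x = lab y \<or> dynkin_adj a (lab x) (lab y)}"
    have R: "(u, y) \<in> ?R\<^sup>+ \<Longrightarrow> (u, y) \<in> le" for u y using generated by blast
    have "(w, y) \<in> ?R\<^sup>+" using that generated by blast
    \<comment> \<open>Follow a generating path from \<open>w\<close> to \<open>y\<close>; its last proper step starts outside \<open>K\<close>.\<close>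
    then have "w \<noteq> y \<longrightarrow> w \<notin> K \<longrightarrow> (\<exists>v. v \<noteq> y \<and> v \<notin> K \<and> (v, y) \<in> ?R)"
    proof (induction rule: converse_trancl_induct)
      case (step u v)
      then show ?case using proper_ideal_down[OF K, of v u] by blast
    qed blast
    then obtain v where v: "v \<noteq> y" "v \<notin> K" "(v, y) \<in> le" "lab v = p \<or> dynkin_adj a (lab v) p"
      using w y by blast
    have vE: "v \<in> E" using v le_in_E by blast
    show False using v(4)
    proof
      assume "lab v = p"
      then show False using ymin[of v] v vE le_antisym[of v y] by auto
    next
      assume "dynkin_adj a (lab v) p"
      then have "v \<in> nbrs_above K p"
        using vE v y ymin le_trans adj_sym[OF p lab_in_P[OF vE]] by (auto simp: nbrs_above_def)
      then show False using none by simp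
    qed
  qed
  have "\<exists>z\<in>E - insert y K. lab z = q" if q: "q \<in> P" for q
  proof (cases "q = p")
    case True
    obtain z where "z \<in> E" "lab z = p" "(z, y) \<notin> le"
      using unbounded_above[OF p] y by blast
    then show ?thesis
      using True comparable[of y z] y proper_ideal_down[OF K, of z y] le_refl[of y] by auto
  next
    case False
    then show ?thesis using K q y unfolding proper_ideal_def by blast
  qed
  moreover have "\<exists>x\<in>insert y K. lab x = q" if "q \<in> P" for q
    using K that unfolding proper_ideal_def by blast
  moreover have "insert y K \<subseteq> E" using y proper_ideal_sub[OF K] by blast
  moreover have "w \<in> insert y K" if "x \<in> insert y K" "(w, x) \<in> le" for x w
    using that down proper_ideal_down[OF K] by blast
  ultimately have "proper_ideal (insert y K)" unfolding proper_ideal_def by blast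
  then show ?thesis using y by blast
qed

text \<open>Reversing the order exchanges ideals with complements of ideals and \<open>nbrs_below\<close> with
  \<open>nbrs_above\<close>; it turns statements about adding elements into statements about removing them.\<close>

lemma dual: "simply_laced_full_heap P a E (le\<inverse>) lab"
proof -
  let ?R = "{(x, y) \<in> le. lab x = lab y \<or> dynkin_adj a (lab x) (lab y)}"
  have int: "open_interval (le\<inverse>) x y = open_interval le y x" for x y
    by (auto simp: open_interval_def)
  show ?thesis
  proof unfold_locales
    show "partial_order_on E (le\<inverse>)" using partial_order by simp
    show "finite {z. (x, z) \<in> le\<inverse> \<and> (z, y) \<in> le\<inverse>}" for x y
      using locally_finite[of y x] by (simp add: conj_commute)
    show "lab ` E \<subseteq> P" by (rule labels)
    show "(x, y) \<in> le\<inverse> \<or> (y, x) \<in> le\<inverse>"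
      if "x \<in> E" "y \<in> E" "lab x = lab y \<or> dynkin_adj a (lab x) (lab y)" for x y
      using comparable[OF that] by auto
    have "{(x, y) \<in> le\<inverse>. lab x = lab y \<or> dynkin_adj a (lab x) (lab y)} = ?R\<inverse>"
      using le_in_E lab_in_P adj_sym by auto
    then show "le\<inverse> = {(x, y) \<in> le\<inverse>. lab x = lab y \<or> dynkin_adj a (lab x) (lab y)}\<^sup>+"
      using generated by (simp add: trancl_converse)
    show "\<not> (\<exists>b\<in>E. \<forall>x\<in>E. lab x = p \<longrightarrow> (x, b) \<in> le\<inverse>)" if "p \<in> P" for p
      using unbounded_below[OF that] by blast
    show "\<not> (\<exists>b\<in>E. \<forall>x\<in>E. lab x = p \<longrightarrow> (b, x) \<in> le\<inverse>)" if "p \<in> P" for p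
      using unbounded_above[OF that] by blast
    show "\<exists>y\<in>E. lab y = q \<and> (covers (le\<inverse>) x y \<or> covers (le\<inverse>) y x)"
      if "x \<in> E" "q \<in> P" "dynkin_adj a (lab x) q" for x q
      using neighbour[OF that] by (auto simp: covers_def int)
    show "(\<Sum>z\<in>open_interval (le\<inverse>) x y. a (lab x) (lab z)) = -2"
      if "(x, y) \<in> le\<inverse>" "x \<noteq> y" "lab x = lab y" "\<forall>z\<in>open_interval (le\<inverse>) x y. lab z \<noteq> lab x" for x y
      using interval_sum[of y x] that by (simp add: int)
    show "simply_laced_gcm P a" by (rule gcm)
  qed
qed

lemma proper_ideal_dual:
  assumes "K \<subseteq> E"
  shows "simply_laced_full_heap.proper_ideal P E (le\<inverse>) lab (E - K) \<longleftrightarrow> proper_ideal K"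
proof -
  interpret dual: simply_laced_full_heap P a E "le\<inverse>" lab by (rule dual)
  have EE: "E - (E - K) = K" using assms by blast
  show ?thesis
    unfolding dual.proper_ideal_def proper_ideal_def EE
  proof (intro conj_cong)
    show "(E - K \<subseteq> E) = (K \<subseteq> E)" using assms by blast
    show "(\<forall>x\<in>E - K. \<forall>y. (y, x) \<in> le\<inverse> \<longrightarrow> y \<in> E - K) =
        (\<forall>x\<in>K. \<forall>y. (y, x) \<in> le \<longrightarrow> y \<in> K)"
      using assms le_in_E by blast
  qed blast
qed

lemma removable:
  assumes K: "proper_ideal K" and p: "p \<in> P" and none: "nbrs_below K p = {}"
  shows "\<exists>z\<in>K. lab z = p \<and> proper_ideal (K - {z})"
proof -
  interpret dual: simply_laced_full_heap P a E "le\<inverse>" lab by (rule dual)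
  have KE: "K \<subseteq> E" and EE: "E - (E - K) = K" using K by (auto simp: proper_ideal_def)
  have "dual.nbrs_above (E - K) p = {}"
    using none unfolding dual.nbrs_above_def nbrs_below_def EE by auto
  then obtain z where z: "z \<in> K" "lab z = p" "dual.proper_ideal (insert z (E - K))"
    using dual.addable[of "E - K" p] K p proper_ideal_dual[OF KE] by (auto simp: EE)
  moreover have "insert z (E - K) = E - (K - {z})" using z KE by blast
  ultimately show ?thesis using proper_ideal_dual[of "K - {z}"] KE by auto
qed

lemma heap_character_singleton: "heap_character lab {z} = simple_root (lab z)"
proof -
  have "{x \<in> {z}. lab x = q} = (if q = lab z then {z} else {})" for q by auto
  then show ?thesis by (simp add: heap_character_def simple_root_def fun_eq_iff)
qed

lemma simple_reflection_ideal:
  assumes K: "proper_ideal K" and p: "p \<in> P"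
  shows "\<exists>K'. proper_ideal K' \<and> shift K K' = (\<lambda>q. weight K p * simple_root p q)"
proof -
  consider "weight K p = 1" | "weight K p = 0" | "weight K p = -1"
    using weight_range[OF K p] by blast
  then show ?thesis
  proof cases
    case 1
    then have "nbrs_above K p = {}"
      using nbrs_two[OF K p] by (simp add: weight_def)
    then obtain z where z: "z \<in> E - K" "lab z = p" "proper_ideal (insert z K)"
      using addable[OF K p] by blast
    have "insert z K - K = {z}" using z by blast
    then have "shift K (insert z K) = simple_root p"
      using z shift_subset[of K "insert z K"] by (auto simp: heap_character_singleton)
    then show ?thesis using 1 z by auto
  next
    case 2
    have "shift K K = (\<lambda>q. 0)" by (simp add: shift_def)
    then show ?thesis using 2 K by auto
  next
    case 3
    then have "nbrs_below K p = {}"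
      using nbrs_two[OF K p] by (simp add: weight_def)
    then obtain z where z: "z \<in> K" "lab z = p" "proper_ideal (K - {z})"
      using removable[OF K p] by blast
    have "K - (K - {z}) = {z}" using z by blast
    then have "shift (K - {z}) K = simple_root p"
      using z shift_subset[of "K - {z}" K] by (auto simp: heap_character_singleton)
    then have "shift K (K - {z}) = (\<lambda>q. - simple_root p q)"
      by (subst shift_swap) simp
    then show ?thesis using 3 z by auto
  qed
qed

text \<open>For \<open>v = s u\<close> with a simple reflection \<open>s\<close>, go from \<open>J\<close> to \<open>s J\<close>, apply the claim for \<open>u\<close> there,
  and return by \<open>s\<close>. The map \<open>s\<close> acts on shifts affinely, with the reflection as linear part, so the total shift is
  \<open>n\<close> times \<open>s u\<close>, where \<open>n\<close> is the pairing of \<open>u\<close> with the weight of \<open>s J\<close>; by invariance \<open>n\<close> is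
  also the pairing of \<open>v\<close> with the weight of \<open>J\<close>.\<close>

lemma root_reflection_ideal:
  assumes "I \<subseteq> P" and "v \<in> roots I a" and "proper_ideal J"
  shows "pairing P (weight J) v \<in> {-1, 0, 1} \<and>
    (\<exists>K. proper_ideal K \<and> shift J K = (\<lambda>q. pairing P (weight J) v * v q))"
proof -
  obtain w p where w: "w \<in> weyl_group I a" and p: "p \<in> I" and v: "v = w (simple_root p)"
    using assms(2) by (auto simp: roots_def)
  have "pairing P (weight J) (w (simple_root p)) \<in> {-1, 0, 1} \<and>
    (\<exists>K. proper_ideal K \<and>
      shift J K = (\<lambda>q. pairing P (weight J) (w (simple_root p)) * w (simple_root p) q))"
    using w assms(3)
  proof (induction arbitrary: J)
    case weyl_id
    have pP: "p \<in> P" using p assms(1) by auto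
    then show ?case
      using weight_range[OF weyl_id pP] simple_reflection_ideal[OF weyl_id pP]
      by (simp add: pairing_simple_root[OF finite_P])
  next
    case (weyl_step w' s)
    define u where "u = w' (simple_root p)"
    have sP: "s \<in> P" using weyl_step(2) assms(1) by auto
    have "u \<in> roots I a" using weyl_step(1) p by (auto simp: roots_def u_def)
    then have supp: "\<And>q. q \<notin> I \<Longrightarrow> u q = 0"
      using root_supported_and_norm[OF gcm assms(1)] by blast
    let ?c = "cartan_apply P a u s"
    have refl: "simple_reflection I a s u = (\<lambda>q. u q + (- ?c) * simple_root s q)"
      by (rule simple_reflection_supported[OF finite_P assms(1) supp])
    obtain J' where J': "proper_ideal J'"
      and JJ': "shift J J' = (\<lambda>q. weight J s * simple_root s q)"
      using simple_reflection_ideal[OF weyl_step.prems sP] by blast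
    have wJ': "weight J' q = weight J q - weight J s * a q s" if "q \<in> P" for q
      using weight_shift[OF weyl_step.prems J' that]
      by (simp add: JJ' cartan_apply_multiple cartan_apply_simple_root[OF finite_P sP])
    define n where "n = pairing P (weight J') u"
    have "n = pairing P (\<lambda>q. weight J q + (- weight J s) * a q s) u"
      unfolding n_def pairing_def by (intro sum.cong) (simp_all add: wJ')
    also have "\<dots> = pairing P (weight J) u - weight J s * ?c"
      unfolding pairing_add_left_multiple pairing_cartan_column[OF gcm sP] by simp
    also have "\<dots> = pairing P (weight J) (simple_reflection I a s u)"
      unfolding refl pairing_add_right_multiple pairing_simple_root[OF finite_P sP] by simp
    finally have n: "pairing P (weight J) (simple_reflection I a s u) = n" by simp
    have nr: "n \<in> {-1, 0, 1}" and "\<exists>K'. proper_ideal K' \<and> shift J' K' = (\<lambda>q. n * u q)"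
      using weyl_step.IH[OF J'] by (auto simp: n_def u_def)
    then obtain K' where K': "proper_ideal K'" and JK': "shift J' K' = (\<lambda>q. n * u q)" by blast
    obtain K where K: "proper_ideal K"
      and KK': "shift K' K = (\<lambda>q. weight K' s * simple_root s q)"
      using simple_reflection_ideal[OF K' sP] by blast
    have wK': "weight K' s = - weight J s - n * ?c"
      using weight_shift[OF J' K' sP] wJ'[OF sP] diag[OF sP] by (simp add: JK' cartan_apply_multiple)
    have "shift J K q = n * simple_reflection I a s u q" for q
      using shift_add[OF weyl_step.prems J' K, of q] shift_add[OF J' K' K, of q]
      by (simp add: JJ' JK' KK' wK' refl algebra_simps)
    then have "shift J K = (\<lambda>q. n * simple_reflection I a s u q)" by (rule ext)
    then show ?case using n nr K by (auto simp: u_def)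
  qed
  then show ?thesis by (simp add: v)
qed

section \<open>Root heaps\<close>

lemma proper_ideal_Un_ideal_of:
  assumes I: "proper_ideal I" and IL: "proper_ideal (I \<union> L)" and L1: "ideal_of le L L1"
  shows "proper_ideal (I \<union> L1)"
proof (rule proper_ideal_between[OF I IL])
  show "I \<union> L1 \<subseteq> I \<union> L" using L1 by (auto simp: ideal_of_def)
  fix x y assume x: "x \<in> I \<union> L1" and yx: "(y, x) \<in> le"
  then have "y \<in> I \<union> L" using proper_ideal_down[OF IL _ yx] L1 by (auto simp: ideal_of_def)
  then show "y \<in> I \<union> L1"
    using x yx L1 proper_ideal_down[OF I _ yx] unfolding ideal_of_def by blast
qed blast

lemma shift_Un: "I \<inter> L = {} \<Longrightarrow> shift I (I \<union> L) = heap_character lab L"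
  by (simp add: shift_subset Un_Diff Diff_triv Int_commute)

text \<open>Adding \<open>L\<close> lowers the pairing with \<open>v\<close> by the norm \<open>2\<close> of \<open>v\<close>, and both values lie in
  \<open>{-1, 0, 1}\<close>.\<close>

lemma pairing_root_heap:
  assumes "I \<subseteq> P" "v \<in> roots I a" "proper_ideal J" "proper_ideal (J \<union> L)" "J \<inter> L = {}"
    and "heap_character lab L = v"
  shows "pairing P (weight J) v = 1"
proof -
  have "pairing P (weight (J \<union> L)) v = pairing P (\<lambda>q. weight J q + (-1) * cartan_apply P a v q) v"
    unfolding pairing_def using assms(6)
    by (intro sum.cong refl) (simp add: weight_shift[OF assms(3,4)] shift_Un[OF assms(5)])
  also have "\<dots> = pairing P (weight J) v - 2"
    unfolding pairing_add_left_multiple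
    using root_supported_and_norm[OF gcm assms(1,2)] by (simp add: pairing_commute)
  finally show ?thesis
    using root_reflection_ideal[OF assms(1,2,3)] root_reflection_ideal[OF assms(1,2,4)] by auto
qed

text \<open>A chain is unbounded below, so it descends past each element of \<open>S\<close> in turn; the lower of two
  elements that avoid parts of \<open>S\<close> avoids both parts.\<close>

lemma not_above_finite:
  assumes "finite S" "S \<subseteq> E" "p \<in> P" "E \<noteq> {}"
  shows "\<exists>x\<in>E. lab x = p \<and> (\<forall>s\<in>S. (s, x) \<notin> le)"
  using assms(1,2)
proof induction
  case empty
  show ?case using unbounded_below[OF assms(3)] assms(4) by blast
next
  case (insert s S)
  then obtain x where x: "x \<in> E" "lab x = p" "\<forall>s\<in>S. (s, x) \<notin> le" by auto
  obtain y where y: "y \<in> E" "lab y = p" "(s, y) \<notin> le"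
    using unbounded_below[OF assms(3)] insert.prems by auto
  have "(x, y) \<in> le \<or> (y, x) \<in> le" using comparable x y by auto
  then show ?case using x y le_trans by (metis insert_iff)
qed

text \<open>The ideal \<open>I\<close> is the complement of the filter generated by \<open>L\<close> and one further element \<open>g p\<close> of
  each chain. Taking \<open>g p\<close> below no element of \<open>L\<close> keeps \<open>I \<union> L\<close> an ideal, while
  these elements guarantee that no chain is swallowed.\<close>

lemma cut_below_subheap:
  assumes L: "L \<subseteq> E" "finite L" "order_convex le L" "L \<noteq> {}"
  obtains I where "proper_ideal I" "proper_ideal (I \<union> L)" "I \<inter> L = {}"
proof -
  interpret dual: simply_laced_full_heap P a E "le\<inverse>" lab by (rule dual)
  have E: "E \<noteq> {}" using L by auto
  have "\<exists>g. \<forall>p\<in>P. g p \<in> E \<and> lab (g p) = p \<and> (\<forall>s\<in>L. (g p, s) \<notin> le)"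
    using dual.not_above_finite[OF L(2,1) _ E] by (intro bchoice) auto
  then obtain g where g: "\<And>p. p \<in> P \<Longrightarrow> g p \<in> E" "\<And>p. p \<in> P \<Longrightarrow> lab (g p) = p"
    "\<And>p s. p \<in> P \<Longrightarrow> s \<in> L \<Longrightarrow> (g p, s) \<notin> le" by blast
  define S where "S = L \<union> g ` P"
  have S: "finite S" "S \<subseteq> E" using L finite_P g by (auto simp: S_def)
  define I where "I = {x \<in> E. \<forall>s\<in>S. (s, x) \<notin> le}"
  have downI: "y \<in> I" if "x \<in> I" "(y, x) \<in> le" for x y
    using that le_trans le_in_E unfolding I_def by blast
  have downIL: "y \<in> I \<union> L" if x: "x \<in> I \<union> L" and yx: "(y, x) \<in> le" for x y
  proof (cases "x \<in> I \<or> y \<in> I")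
    case True then show ?thesis using downI yx by blast
  next
    case False
    then have xL: "x \<in> L" using x by blast
    obtain s where s: "s \<in> S" "(s, y) \<in> le" using False yx le_in_E unfolding I_def by blast
    have "(s, x) \<in> le" using s yx le_trans by blast
    then have "s \<in> L" using s g xL by (auto simp: S_def)
    then show ?thesis using L(3) xL s yx unfolding order_convex_def by blast
  qed
  have meets: "\<exists>x\<in>I. lab x = p" if "p \<in> P" for p
    using not_above_finite[OF S that E] unfolding I_def by blast
  have misses: "\<exists>y\<in>E - (I \<union> L). lab y = p" if p: "p \<in> P" for p
  proof -
    have "g p \<notin> L" using g(3)[OF p, of "g p"] le_refl[OF g(1)[OF p]] by blast
    moreover have "g p \<notin> I" using le_refl[OF g(1)[OF p]] p by (auto simp: I_def S_def)
    ultimately show ?thesis using g(1,2)[OF p] by blast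
  qed
  show thesis
  proof (rule that[of I])
    have IE: "I \<subseteq> E" by (auto simp: I_def)
    show IL: "proper_ideal (I \<union> L)" unfolding proper_ideal_def
    proof (intro conjI ballI allI impI)
      fix p assume "p \<in> P"
      then show "\<exists>x\<in>I \<union> L. lab x = p" using meets by blast
    qed (use IE L(1) downIL misses in blast)+
    show "proper_ideal I" unfolding proper_ideal_def
    proof (intro conjI ballI allI impI)
      fix p assume "p \<in> P"
      then show "\<exists>y\<in>E - I. lab y = p" using misses by blast
    qed (use IE downI meets in blast)+
    show "I \<inter> L = {}" using le_refl by (auto simp: I_def S_def)
  qed
qed

lemma subheap_of_ideal_filter:
  assumes "L \<in> subheaps_of_character E le lab u" "ideal_of le L M \<or> filter_of le L M"
  shows "M \<in> subheaps_of_character E le lab (heap_character lab M)"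
proof -
  have "M \<subseteq> L" using assms(2) by (auto simp: ideal_of_def filter_of_def)
  then have "M \<subseteq> E" "finite M" using assms(1) by (auto simp: subheaps_of_character_def intro: finite_subset)
  moreover have "order_convex le M"
    using assms unfolding order_convex_def ideal_of_def filter_of_def subheaps_of_character_def
    by blast
  ultimately show ?thesis by (simp add: subheaps_of_character_def)
qed

text \<open>Let \<open>K\<close> be the image of \<open>I\<close> under the reflection in \<open>\<beta>\<close>. It exceeds \<open>I\<close> by \<open>\<beta>\<close> and is exceeded
  by \<open>I \<union> L\<close> by \<open>\<gamma>\<close>. Both are nonnegative, so \<open>I \<subseteq> K \<subseteq> I \<union> L\<close> and \<open>K\<close> cuts \<open>L\<close> as required.\<close>

lemma ideal_part_exists:
  assumes sub: "Q \<subseteq> P" and \<beta>: "\<beta> \<in> positive_roots Q a"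
    and \<gamma>: "\<And>p. 0 \<le> \<gamma> p" and L: "L \<in> subheaps_of_character E le lab (\<lambda>p. \<beta> p + \<gamma> p)"
    and I: "proper_ideal I" "proper_ideal (I \<union> L)" "I \<inter> L = {}"
    and one: "pairing P (weight I) \<beta> = 1"
  shows "\<exists>L1 L2. L = L1 \<union> L2 \<and> L1 \<inter> L2 = {} \<and> L1 \<in> subheaps_of_character E le lab \<beta> \<and>
    L2 \<in> subheaps_of_character E le lab \<gamma> \<and> ideal_of le L L1 \<and> filter_of le L L2"
proof -
  have \<beta>r: "\<beta> \<in> roots Q a" "\<And>p. 0 \<le> \<beta> p" using \<beta> by (auto simp: positive_roots_def)
  obtain K where K: "proper_ideal K" and IK: "shift I K = \<beta>"
    using root_reflection_ideal[OF sub \<beta>r(1) I(1)] one by auto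
  have IKsub: "I \<subseteq> K" by (rule subset_if_shift_nonneg[OF I(1) K]) (simp add: IK \<beta>r)
  have "heap_character lab L = (\<lambda>p. \<beta> p + \<gamma> p)" using L by (simp add: subheaps_of_character_def)
  then have "shift K (I \<union> L) p = \<gamma> p" for p
    using shift_add[OF I(1) K I(2), of p] by (simp add: shift_Un[OF I(3)] IK)
  then have KL: "shift K (I \<union> L) = \<gamma>" by (rule ext)
  have KLsub: "K \<subseteq> I \<union> L" by (rule subset_if_shift_nonneg[OF K I(2)]) (simp add: KL \<gamma>)
  have "(I \<union> L) - K = L - K" using IKsub by blast
  then have char: "heap_character lab (K - I) = \<beta>" "heap_character lab (L - K) = \<gamma>"
    using IK KL shift_subset[OF IKsub] shift_subset[OF KLsub] by auto
  have idl: "ideal_of le L (K - I)"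
    using KLsub I(3) proper_ideal_down[OF K] unfolding ideal_of_def by blast
  have fil: "filter_of le L (L - K)"
    using proper_ideal_down[OF K] unfolding filter_of_def by blast
  have "L = (K - I) \<union> (L - K)" "(K - I) \<inter> (L - K) = {}" using KLsub I(3) by auto
  then show ?thesis
    using subheap_of_ideal_filter[OF L, of "K - I"] subheap_of_ideal_filter[OF L, of "L - K"]
      idl fil char by blast
qed

lemma ideal_part_unique:
  assumes I: "proper_ideal I" "proper_ideal (I \<union> L)" "I \<inter> L = {}"
    and "ideal_of le L M" "ideal_of le L N" "heap_character lab M = heap_character lab N"
  shows "M = N"
proof -
  have sub: "M \<subseteq> N"
    if "ideal_of le L M" "ideal_of le L N" "heap_character lab M = heap_character lab N" for M N
  proof -
    have disj: "I \<inter> M = {}" "I \<inter> N = {}" using that I(3) by (auto simp: ideal_of_def)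
    have IM: "proper_ideal (I \<union> M)" and IN: "proper_ideal (I \<union> N)"
      using proper_ideal_Un_ideal_of[OF I(1,2)] that by auto
    have "shift (I \<union> M) (I \<union> N) p = 0" for p
      using shift_add[OF I(1) IM IN, of p] that(3) by (simp add: shift_Un disj)
    then have "I \<union> M \<subseteq> I \<union> N" by (intro subset_if_shift_nonneg[OF IM IN]) simp
    then show ?thesis using disj by blast
  qed
  show ?thesis using sub[of M N] sub[of N M] assms by auto
qed

lemma root_heap_decomposition:
  assumes sub: "Q \<subseteq> P"
    and \<alpha>: "\<alpha> \<in> positive_roots Q a" and \<beta>: "\<beta> \<in> positive_roots Q a"
    and \<gamma>: "\<gamma> \<in> positive_roots Q a" and sum: "\<alpha> = (\<lambda>p. \<beta> p + \<gamma> p)"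
    and L: "L \<in> subheaps_of_character E le lab \<alpha>"
  shows "\<exists>!(L1, L2).
      L = L1 \<union> L2 \<and> L1 \<inter> L2 = {} \<and>
      L1 \<in> subheaps_of_character E le lab \<beta> \<and>
      L2 \<in> subheaps_of_character E le lab \<gamma> \<and>
      (ideal_of le L L1 \<and> filter_of le L L2 \<or> filter_of le L L1 \<and> ideal_of le L L2)"
proof -
  let ?S = "subheaps_of_character E le lab"
  let ?D = "\<lambda>u v L1 L2. L = L1 \<union> L2 \<and> L1 \<inter> L2 = {} \<and> L1 \<in> ?S u \<and> L2 \<in> ?S v \<and>
    (ideal_of le L L1 \<and> filter_of le L L2 \<or> filter_of le L L1 \<and> ideal_of le L L2)"
  have roots: "\<alpha> \<in> roots Q a" "\<beta> \<in> roots Q a" "\<gamma> \<in> roots Q a"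
    using \<alpha> \<beta> \<gamma> by (auto simp: positive_roots_def)
  have Lprops: "L \<subseteq> E" "finite L" "order_convex le L" "heap_character lab L = \<alpha>"
    using L by (auto simp: subheaps_of_character_def)
  have "L \<noteq> {}"
  proof
    assume "L = {}"
    then have "\<alpha> = (\<lambda>p. 0)" using Lprops(4) by (auto simp: heap_character_def)
    then show False
      using root_supported_and_norm[OF gcm sub roots(1)] by (simp add: pairing_def)
  qed
  then obtain I where I: "proper_ideal I" "proper_ideal (I \<union> L)" "I \<inter> L = {}"
    using cut_below_subheap Lprops by blast
  let ?w = "pairing P (weight I)"
  have "?w \<alpha> = 1" by (rule pairing_root_heap[OF sub roots(1) I Lprops(4)])
  moreover have "?w \<alpha> = ?w \<beta> + ?w \<gamma>"
    using pairing_add_right_multiple[of P "weight I" \<beta> 1 \<gamma>] by (simp add: sum)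
  moreover have "?w \<beta> \<in> {-1, 0, 1}" "?w \<gamma> \<in> {-1, 0, 1}"
    using root_reflection_ideal[OF sub roots(2) I(1)] root_reflection_ideal[OF sub roots(3) I(1)]
    by blast+
  \<comment> \<open>The sum \<open>1\<close> of two values in \<open>{-1, 0, 1}\<close> is only possible as \<open>1 + 0\<close> or \<open>0 + 1\<close>.\<close>
  ultimately have dichotomy: "(?w \<beta> = 1 \<and> ?w \<gamma> \<noteq> 1) \<or> (?w \<gamma> = 1 \<and> ?w \<beta> \<noteq> 1)" by auto
  have ideal_one: "?w v = 1" if "ideal_of le L M" "M \<in> ?S v" "v \<in> roots Q a" for M v
    using that I proper_ideal_Un_ideal_of[OF I(1,2) that(1)]
    by (intro pairing_root_heap[OF sub, of _ _ M])
      (auto simp: subheaps_of_character_def ideal_of_def)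
  have split: "\<exists>M N. ?D u v M N \<and> (\<forall>M' N'. ?D u v M' N' \<longrightarrow> M' = M \<and> N' = N)"
    if u: "u \<in> positive_roots Q a" and v: "v \<in> positive_roots Q a"
      and Luv: "L \<in> ?S (\<lambda>p. u p + v p)" and w: "?w u = 1" "?w v \<noteq> 1" for u v
  proof -
    have vr: "v \<in> roots Q a" "\<And>p. 0 \<le> v p" using v by (auto simp: positive_roots_def)
    obtain M N where MN: "?D u v M N" and M: "ideal_of le L M"
      using ideal_part_exists[OF sub u vr(2) Luv I w(1)] by blast
    have "M' = M \<and> N' = N" if D: "?D u v M' N'" for M' N'
    proof -
      \<comment> \<open>Otherwise \<open>N'\<close> would be an ideal of \<open>L\<close>, which forces the pairing with \<open>v\<close> to be \<open>1\<close>.\<close>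
      have "ideal_of le L M'" using D ideal_one[of N' v] vr w by blast
      moreover have "heap_character lab M' = heap_character lab M"
        using D MN by (simp add: subheaps_of_character_def)
      ultimately have "M' = M" using ideal_part_unique[OF I _ M] by blast
      moreover have "N' = L - M'" "N = L - M" using D MN by blast+
      ultimately show ?thesis by blast
    qed
    then show ?thesis using MN by blast
  qed
  show ?thesis
    using dichotomy
  proof
    assume w: "?w \<beta> = 1 \<and> ?w \<gamma> \<noteq> 1"
    have "L \<in> ?S (\<lambda>p. \<beta> p + \<gamma> p)" using L sum by simp
    then obtain L1 L2 where "?D \<beta> \<gamma> L1 L2" "\<And>M N. ?D \<beta> \<gamma> M N \<Longrightarrow> M = L1 \<and> N = L2"
      using split[OF \<beta> \<gamma>] w by blast
    then show ?thesis by (rule ex1_pairI)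
  next
    assume w: "?w \<gamma> = 1 \<and> ?w \<beta> \<noteq> 1"
    have swap: "?D \<gamma> \<beta> M N \<longleftrightarrow> ?D \<beta> \<gamma> N M" for M N by blast
    have "L \<in> ?S (\<lambda>p. \<gamma> p + \<beta> p)" using L sum by (simp add: add.commute)
    then obtain L2 L1 where "?D \<gamma> \<beta> L2 L1" "\<And>M N. ?D \<gamma> \<beta> M N \<Longrightarrow> M = L2 \<and> N = L1"
      using split[OF \<gamma> \<beta>] w by blast
    then have "?D \<beta> \<gamma> L1 L2" "\<And>M N. ?D \<beta> \<gamma> M N \<Longrightarrow> M = L1 \<and> N = L2"
      unfolding swap by blast+
    then show ?thesis by (rule ex1_pairI)
  qed
qed

end

theorem corollary5p5:
  fixes P :: "'p set" and a :: "'p \<Rightarrow> 'p \<Rightarrow> int" and o0 :: 'p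
    and E :: "'e set" and le :: "'e rel" and lab :: "'e \<Rightarrow> 'p"
    and \<alpha> \<beta> \<gamma> :: "'p \<Rightarrow> int" and L :: "'e set"
  assumes "simply_laced_gcm P a"
    and "untwisted_affine P a o0"
    and "full_heap P a E le lab"
    and "\<alpha> \<in> positive_roots (P - {o0}) a"
    and "\<beta> \<in> positive_roots (P - {o0}) a"
    and "\<gamma> \<in> positive_roots (P - {o0}) a"
    and "\<alpha> = (\<lambda>p. \<beta> p + \<gamma> p)"
    and "L \<in> subheaps_of_character E le lab \<alpha>"
  shows "\<exists>!(L1, L2).
      L = L1 \<union> L2 \<and> L1 \<inter> L2 = {} \<and>
      L1 \<in> subheaps_of_character E le lab \<beta> \<and>
      L2 \<in> subheaps_of_character E le lab \<gamma> \<and>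
      (ideal_of le L L1 \<and> filter_of le L L2 \<or> filter_of le L L1 \<and> ideal_of le L L2)"
proof -
  interpret full_heap P a E le lab by (rule assms(3))
  interpret simply_laced_full_heap P a E le lab
    by unfold_locales (rule assms(1))
  show ?thesis
    by (rule root_heap_decomposition[OF _ assms(4-8)]) blast
qed

end
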